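(* Let $\Gamma$ be a weighted digraph with normalized matrix of maximum out forests $\bar J=(\bar J_{ij})$. For any $i,j\in\{1,\dots,n\}$: 1. $\bar J_{ii}\ge\bar J_{ji}$. 2. If $\bar J_{ii}>\bar J_{ji}$, then $i\in\tilde K$ and $j\notin K^+(i)$; therefore $\Gamma$ contains no path from $j$ to $i$. 3. If $\bar J_{ii}>\bar J_{ji}>0$, then $j\notin\tilde K$; consequently $j$ is not a root in any maximum out forest of $\Gamma$. 4. If $\bar J_{ij}>0$, then $\bar J_{ii}=\bar J_{ji}$.
   Context: $\Gamma$: loopless digraph on $\{1,\dots,n\}$, $n>1$, arc weights $\varepsilon_{ij}>0$; weight of a subgraph = product of arc weights (1 if no arcs), weight of a set = sum (0 if empty). $w$ is reachable from $z$ if $w=z$ or there is a directed path from $z$ to $w$. A diverging forest is a digraph without circuits with all indegrees $\le1$; roots are indegree-0 vertices, each weak component is a tree diverging from a root. A maximum out forest of $\Gamma$ is a spanning diverging forest with maximum number of arcs; its number of roots is the forest dimension $v$. $\mathcal F_k^{j\to i}$: spanning diverging forests with $k$ arcs in which $i$ is in the tree rooted at $j$; $\mathcal F_k$: all spanning diverging forests with $k$ arcs. $\bar J_{ij}=\varepsilon(\mathcal F^{j\to i}_{n-v})/\varepsilon(\mathcal F_{n-v})$. An undominated knot is a nonempty $K\subseteq V(\Gamma)$ whose vertices are mutually reachable and with no arc from outside $K$ into $K$; $\tilde K$ is the union of undominated knots; for $i\in\tilde K$, $K(i)$ is the undominated knot containing $i$ and $K^+(i)$ is the set of vertices reachable from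 $K(i)$ and unreachable from every other undominated knot. *)

theory Defs
  imports Complex_Main
begin

text \<open>A digraph on the vertices \<open>{1..n}\<close> is given by its arc set \<open>E\<close>; the pair \<open>(z, w)\<close> is the
  arc from \<open>z\<close> to \<open>w\<close>, and \<open>(z, w) \<in> E\<^sup>*\<close> says that \<open>w\<close> is reachable from \<open>z\<close>. The arc
  \<open>(z, w)\<close> has weight \<open>\<epsilon> z w\<close>. A spanning subgraph is identified with its arc set.\<close>

definition weighted_digraph :: "nat \<Rightarrow> (nat \<times> nat) set \<Rightarrow> (nat \<Rightarrow> nat \<Rightarrow> real) \<Rightarrow> bool" where
  "weighted_digraph n E \<epsilon> \<longleftrightarrow>
     n > 1 \<and> E \<subseteq> {1..n} \<times> {1..n} \<and> irrefl E \<and> (\<forall>(z, w) \<in> E. \<epsilon> z w > 0)"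

definition weight :: "(nat \<Rightarrow> nat \<Rightarrow> real) \<Rightarrow> (nat \<times> nat) set \<Rightarrow> real" where
  "weight \<epsilon> F = (\<Prod>(z, w) \<in> F. \<epsilon> z w)"

definition total_weight :: "(nat \<Rightarrow> nat \<Rightarrow> real) \<Rightarrow> (nat \<times> nat) set set \<Rightarrow> real" where
  "total_weight \<epsilon> \<F> = (\<Sum>F \<in> \<F>. weight \<epsilon> F)"

definition indegree :: "(nat \<times> nat) set \<Rightarrow> nat \<Rightarrow> nat" where
  "indegree F w = card {z. (z, w) \<in> F}"

definition diverging_forest :: "nat \<Rightarrow> (nat \<times> nat) set \<Rightarrow> bool" where
  "diverging_forest n F \<longleftrightarrow> acyclic F \<and> (\<forall>w \<in> {1..n}. indegree F w \<le> 1)"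

definition roots :: "nat \<Rightarrow> (nat \<times> nat) set \<Rightarrow> nat set" where
  "roots n F = {w \<in> {1..n}. indegree F w = 0}"

definition spanning_forests :: "nat \<Rightarrow> (nat \<times> nat) set \<Rightarrow> (nat \<times> nat) set set" where
  "spanning_forests n E = {F. F \<subseteq> E \<and> diverging_forest n F}"

definition maximum_out_forest :: "nat \<Rightarrow> (nat \<times> nat) set \<Rightarrow> (nat \<times> nat) set \<Rightarrow> bool" where
  "maximum_out_forest n E F \<longleftrightarrow>
     F \<in> spanning_forests n E \<and> (\<forall>F' \<in> spanning_forests n E. card F' \<le> card F)"

text \<open>All maximum out forests have the same number of roots, because a diverging forest on
  \<open>{1..n}\<close> with \<open>k\<close> arcs has \<open>n - k\<close> roots.\<close>

definition forest_dimension :: "nat \<Rightarrow> (nat \<times> nat) set \<Rightarrow> nat" where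
  "forest_dimension n E = (THE v. \<exists>F. maximum_out_forest n E F \<and> v = card (roots n F))"

definition forests :: "nat \<Rightarrow> (nat \<times> nat) set \<Rightarrow> nat \<Rightarrow> (nat \<times> nat) set set" where
  "forests n E k = {F \<in> spanning_forests n E. card F = k}"

text \<open>The tree of a diverging forest \<open>F\<close> rooted at \<open>j\<close> is the weak component of the root \<open>j\<close>.\<close>

definition tree_rooted_at :: "nat \<Rightarrow> (nat \<times> nat) set \<Rightarrow> nat \<Rightarrow> nat set" where
  "tree_rooted_at n F j = {i \<in> {1..n}. j \<in> roots n F \<and> (j, i) \<in> (F \<union> F\<inverse>)\<^sup>*}"

definition forests_to :: "nat \<Rightarrow> (nat \<times> nat) set \<Rightarrow> nat \<Rightarrow> nat \<Rightarrow> nat \<Rightarrow> (nat \<times> nat) set set" where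
  "forests_to n E k j i = {F \<in> forests n E k. i \<in> tree_rooted_at n F j}"

text \<open>In \<open>Jbar n E \<epsilon> i j\<close>, the row index \<open>i\<close> is the vertex reached and the column index \<open>j\<close> is
  the root.\<close>

definition Jbar :: "nat \<Rightarrow> (nat \<times> nat) set \<Rightarrow> (nat \<Rightarrow> nat \<Rightarrow> real) \<Rightarrow> nat \<Rightarrow> nat \<Rightarrow> real" where
  "Jbar n E \<epsilon> i j =
     total_weight \<epsilon> (forests_to n E (n - forest_dimension n E) j i) /
     total_weight \<epsilon> (forests n E (n - forest_dimension n E))"

definition undominated_knots :: "nat \<Rightarrow> (nat \<times> nat) set \<Rightarrow> nat set set" where
  "undominated_knots n E =
     {K. K \<noteq> {} \<and> K \<subseteq> {1..n} \<and> (\<forall>z \<in> K. \<forall>w \<in> K. (z, w) \<in> E\<^sup>*) \<and>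
         \<not> (\<exists>z w. z \<notin> K \<and> w \<in> K \<and> (z, w) \<in> E)}"

definition Ktilde :: "nat \<Rightarrow> (nat \<times> nat) set \<Rightarrow> nat set" where
  "Ktilde n E = \<Union> (undominated_knots n E)"

text \<open>Distinct undominated knots are disjoint, so \<open>knot_of n E i\<close> is determined when
  \<open>i \<in> Ktilde n E\<close>; otherwise it and \<open>Kplus n E i\<close> are unspecified.\<close>

definition knot_of :: "nat \<Rightarrow> (nat \<times> nat) set \<Rightarrow> nat \<Rightarrow> nat set" where
  "knot_of n E i = (THE K. K \<in> undominated_knots n E \<and> i \<in> K)"

definition reachable_from :: "nat \<Rightarrow> (nat \<times> nat) set \<Rightarrow> nat set \<Rightarrow> nat set" where
  "reachable_from n E K = {w \<in> {1..n}. \<exists>z \<in> K. (z, w) \<in> E\<^sup>*}"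

definition Kplus :: "nat \<Rightarrow> (nat \<times> nat) set \<Rightarrow> nat \<Rightarrow> nat set" where
  "Kplus n E i =
     {w \<in> reachable_from n E (knot_of n E i).
        \<forall>K \<in> undominated_knots n E. K \<noteq> knot_of n E i \<longrightarrow> w \<notin> reachable_from n E K}"

end

theory Submission
  imports Defs
begin

text \<open>The roots of a maximum out forest form a set of least cardinality among the sets from which
  every vertex is reachable, because a shortest-path forest realises any such set as its set of
  roots. By minimality a root cannot be reached from another root, nor from a vertex that it does
  not reach itself. Hence the roots lie in undominated knots, one in each knot. So if \<open>j\<close> lies in
  \<open>K\<^sup>+(i)\<close>, every maximum out forest with root \<open>i\<close> has \<open>j\<close> in the tree of \<open>i\<close>; conversely the
  tree of \<open>i\<close> can contain \<open>j\<close> only if \<open>i\<close> is a root, which gives item 1.\<close>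

locale vertex_digraph =
  fixes n :: nat and E :: "(nat \<times> nat) set"
  assumes arcs: "E \<subseteq> {1..n} \<times> {1..n}"
begin

section \<open>Spanning diverging forests: parents, roots and trees\<close>

lemma finite_arcs: "finite E"
  using arcs by (rule finite_subset) simp

lemma finite_spanning_forests: "finite (spanning_forests n E)"
  using finite_arcs unfolding spanning_forests_def by (rule_tac finite_subset[of _ "Pow E"]) auto

lemma finite_forest: "F \<in> spanning_forests n E \<Longrightarrow> finite F"
  using finite_arcs finite_subset unfolding spanning_forests_def by blast

lemma finite_in_neighbours:
  assumes "F \<in> spanning_forests n E"
  shows "finite {z. (z, w) \<in> F}"
  using finite_forest[OF assms] by (rule_tac finite_subset[of _ "fst ` F"]) force+

lemma root_iff:
  assumes "F \<in> spanning_forests n E"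
  shows "r \<in> roots n F \<longleftrightarrow> r \<in> {1..n} \<and> (\<forall>z. (z, r) \<notin> F)"
  using finite_in_neighbours[OF assms, of r] unfolding roots_def indegree_def by auto

lemma forest_parent_unique:
  assumes "F \<in> spanning_forests n E" "(x, w) \<in> F" "(y, w) \<in> F"
  shows "x = y"
proof -
  have "w \<in> {1..n}" "card {z. (z, w) \<in> F} \<le> Suc 0"
    using assms arcs by (auto simp: spanning_forests_def diverging_forest_def indegree_def)
  then show ?thesis
    using assms(2,3) finite_in_neighbours[OF assms(1), of w] by (simp add: card_le_Suc0_iff_eq)
qed

text \<open>Each non-root has exactly one incoming arc, so \<open>snd\<close> maps the arcs
  bijectively onto the non-roots. Maximising arcs thus means minimising roots.\<close>

lemma card_forest_roots:
  assumes F: "F \<in> spanning_forests n E"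
  shows "card F + card (roots n F) = n"
proof -
  have "inj_on snd F"
    using forest_parent_unique[OF F] by (auto simp: inj_on_def)
  then have "card F = card (snd ` F)"
    by (simp add: card_image)
  moreover have "snd ` F = {1..n} - roots n F"
    using F arcs root_iff[OF F] by (force simp: spanning_forests_def)
  moreover have "roots n F \<subseteq> {1..n}"
    by (auto simp: roots_def)
  ultimately show ?thesis
    using card_mono[of "{1..n}" "roots n F"] by (simp add: card_Diff_subset finite_subset)
qed

lemma root_above:
  assumes F: "F \<in> spanning_forests n E" and "v \<in> {1..n}"
  shows "\<exists>r \<in> roots n F. (r, v) \<in> F\<^sup>*"
proof -
  have "wf F"
    using F finite_forest finite_acyclic_wf by (auto simp: spanning_forests_def diverging_forest_def)
  then show ?thesis using \<open>v \<in> {1..n}\<close>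
  proof (induction v)
    case (less v)
    show ?case
    proof (cases "v \<in> roots n F")
      case False
      then obtain z where z: "(z, v) \<in> F"
        using less.prems root_iff[OF F] by auto
      then have "z \<in> {1..n}"
        using F arcs by (auto simp: spanning_forests_def)
      then show ?thesis
        using less.IH[OF z] z by (meson rtrancl.rtrancl_into_rtrancl)
    qed auto
  qed
qed

text \<open>An undirected walk starting at a root never leaves its descendants: a forward arc
  prolongs the directed path, a backward arc shortens it.\<close>

lemma tree_rooted_at_iff:
  assumes F: "F \<in> spanning_forests n E"
  shows "i \<in> tree_rooted_at n F j \<longleftrightarrow> i \<in> {1..n} \<and> j \<in> roots n F \<and> (j, i) \<in> F\<^sup>*"
proof -
  have "(j, i) \<in> F\<^sup>*" if "(j, i) \<in> (F \<union> F\<inverse>)\<^sup>*" "j \<in> roots n F"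
    using that(1)
  proof (induction rule: rtrancl_induct)
    case (step x y)
    show ?case
    proof (cases "(x, y) \<in> F")
      case False
      then have yx: "(y, x) \<in> F"
        using step.hyps by auto
      \<comment> \<open>The root has no parent, so the directed path to \<open>x\<close> is
        nonempty; uniqueness of parents makes \<open>y\<close> its penultimate vertex.\<close>
      then have "x \<noteq> j"
        using that(2) root_iff[OF F] by auto
      then obtain z where "(j, z) \<in> F\<^sup>*" "(z, x) \<in> F"
        using step.IH by (metis rtranclE)
      then show ?thesis
        using forest_parent_unique[OF F yx] by auto
    qed (use step.IH in auto)
  qed simp
  moreover have "F\<^sup>* \<subseteq> (F \<union> F\<inverse>)\<^sup>*"
    by (rule rtrancl_mono) auto
  ultimately show ?thesis
    by (auto simp: tree_rooted_at_def)
qed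

lemma forest_reachable:
  "F \<in> spanning_forests n E \<Longrightarrow> (x, y) \<in> F\<^sup>* \<Longrightarrow> (x, y) \<in> E\<^sup>*"
  using rtrancl_mono[of F E] by (auto simp: spanning_forests_def)

text \<open>Each vertex outside \<open>R\<close> is joined to a predecessor strictly closer to
  \<open>R\<close>, so distance grows along arcs and no circuit can close.\<close>

lemma shortest_path_forest:
  assumes R: "R \<subseteq> {1..n}" and reach: "\<And>v. v \<in> {1..n} \<Longrightarrow> \<exists>r \<in> R. (r, v) \<in> E\<^sup>*"
  shows "\<exists>F \<in> spanning_forests n E. roots n F = R"
proof -
  define d where "d v = (LEAST k. \<exists>r \<in> R. (r, v) \<in> E ^^ k)" for v
  have "\<exists>p. (p, v) \<in> E \<and> d p < d v" if v: "v \<in> {1..n} - R" for v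
  proof -
    have "\<exists>k. \<exists>r \<in> R. (r, v) \<in> E ^^ k"
      using reach[of v] v by (auto simp: rtrancl_power)
    then have "\<exists>r \<in> R. (r, v) \<in> E ^^ d v"
      unfolding d_def by (rule LeastI_ex)
    then obtain r where r: "r \<in> R" "(r, v) \<in> E ^^ d v"
      by blast
    \<comment> \<open>Distance 0 would put \<open>v\<close> into \<open>R\<close>; the last arc of a
      shortest path supplies the parent.\<close>
    then obtain k where k: "d v = Suc k"
      using v by (cases "d v") auto
    then obtain p where p: "(r, p) \<in> E ^^ k" "(p, v) \<in> E"
      using r by auto
    have "d p \<le> k"
      unfolding d_def using r(1) p(1) by (intro Least_le) auto
    then show ?thesis
      using p k by auto
  qed
  then obtain p where p: "\<And>v. v \<in> {1..n} - R \<Longrightarrow> (p v, v) \<in> E \<and> d (p v) < d v"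
    by metis
  define F where "F = (\<lambda>v. (p v, v)) ` ({1..n} - R)"
  have "F \<subseteq> measure d"
    using p by (auto simp: F_def)
  then have "acyclic F"
    using wf_acyclic wf_subset wf_measure by blast
  moreover have "indegree F w \<le> 1" for w
  proof -
    have "{z. (z, w) \<in> F} \<subseteq> {p w}"
      by (auto simp: F_def)
    then show ?thesis
      using card_mono[of "{p w}"] by (simp add: indegree_def)
  qed
  moreover have "F \<subseteq> E"
    using p by (auto simp: F_def)
  ultimately have F: "F \<in> spanning_forests n E"
    by (auto simp: spanning_forests_def diverging_forest_def)
  moreover have "roots n F = R"
    using R root_iff[OF F] unfolding F_def by (auto simp del: atLeastAtMost_iff)
  ultimately show ?thesis
    by blast
qed

section \<open>Maximum out forests and their roots\<close>

lemma maximum_out_forest_exists: "\<exists>F. maximum_out_forest n E F"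
proof -
  have "{} \<in> spanning_forests n E"
    by (simp add: spanning_forests_def diverging_forest_def indegree_def acyclic_def)
  then have "Max (card ` spanning_forests n E) \<in> card ` spanning_forests n E"
    using finite_spanning_forests by (intro Max_in) auto
  then obtain F where "F \<in> spanning_forests n E" "card F = Max (card ` spanning_forests n E)"
    by auto
  then show ?thesis
    using finite_spanning_forests by (auto simp: maximum_out_forest_def)
qed

lemma maximum_out_forest_card:
  assumes "maximum_out_forest n E F"
  shows "card F = n - forest_dimension n E"
proof -
  have "forest_dimension n E = card (roots n F)"
    unfolding forest_dimension_def
  proof (rule the_equality)
    fix v
    assume "\<exists>G. maximum_out_forest n E G \<and> v = card (roots n G)"
    then obtain G where G: "maximum_out_forest n E G" "v = card (roots n G)"
      by blast
    then have "card G = card F"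
      using assms by (auto simp: maximum_out_forest_def intro: antisym)
    then show "v = card (roots n F)"
      using G assms card_forest_roots[of F] card_forest_roots[of G]
      by (auto simp: maximum_out_forest_def)
  qed (use assms in auto)
  then show ?thesis
    using assms card_forest_roots[of F] by (auto simp: maximum_out_forest_def)
qed

text \<open>Translates the arc count in \<open>Jbar\<close> into the extremal property, which the
  later arguments use.\<close>

lemma forests_maximum:
  "forests n E (n - forest_dimension n E) = {F. maximum_out_forest n E F}"
proof -
  obtain F where F: "maximum_out_forest n E F"
    using maximum_out_forest_exists by blast
  then have "maximum_out_forest n E G"
    if "G \<in> forests n E (n - forest_dimension n E)" for G
    using that maximum_out_forest_card[OF F] by (auto simp: maximum_out_forest_def forests_def)
  moreover have "G \<in> forests n E (n - forest_dimension n E)" if "maximum_out_forest n E G" for G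
    using that maximum_out_forest_card[OF that] by (simp add: forests_def maximum_out_forest_def)
  ultimately show ?thesis
    by blast
qed

text \<open>Otherwise \<open>s\<close> would reach whatever \<open>r\<close> reaches,
  \<open>r\<close> could be dropped from the root set, and a forest with fewer roots has more
  arcs.\<close>

lemma maximum_roots_not_redundant:
  assumes F: "maximum_out_forest n E F"
    and "r \<in> roots n F" "s \<in> roots n F" "(s, r) \<in> E\<^sup>*"
  shows "s = r"
proof (rule ccontr)
  assume "s \<noteq> r"
  have sF: "F \<in> spanning_forests n E"
    using F by (simp add: maximum_out_forest_def)
  have "\<exists>t \<in> roots n F - {r}. (t, v) \<in> E\<^sup>*" if v: "v \<in> {1..n}" for v
  proof -
    obtain t where t: "t \<in> roots n F" "(t, v) \<in> E\<^sup>*"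
      using root_above[OF sF v] forest_reachable[OF sF] by blast
    show ?thesis
    proof (cases "t = r")
      case True
      then have "(s, v) \<in> E\<^sup>*"
        using t assms(4) by auto
      then show ?thesis
        using assms(3) \<open>s \<noteq> r\<close> by auto
    qed (use t in auto)
  qed
  moreover have "roots n F - {r} \<subseteq> {1..n}"
    by (auto simp: roots_def)
  ultimately obtain G where G: "G \<in> spanning_forests n E" "roots n G = roots n F - {r}"
    using shortest_path_forest by metis
  have "finite (roots n F)"
    by (simp add: roots_def)
  then have "card (roots n G) < card (roots n F)"
    using assms(2) G(2) by (metis card_Diff1_less)
  moreover have "card G \<le> card F"
    using F G by (simp add: maximum_out_forest_def)
  ultimately show False
    using card_forest_roots[OF G(1)] card_forest_roots[OF sF] by simp
qed

lemma maximum_root_in_Ktilde: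
  assumes F: "maximum_out_forest n E F" and r: "r \<in> roots n F"
  shows "r \<in> Ktilde n E"
proof -
  have sF: "F \<in> spanning_forests n E"
    using F by (simp add: maximum_out_forest_def)
  have rV: "r \<in> {1..n}"
    using r by (simp add: roots_def)
  \<comment> \<open>The ancestors of \<open>r\<close> are closed under predecessors by construction;
    only mutual reachability needs maximality.\<close>
  define K where "K = {z. (z, r) \<in> E\<^sup>*}"
  have KV: "K \<subseteq> {1..n}"
  proof
    fix z
    assume "z \<in> K"
    then have "(z, r) \<in> E\<^sup>*"
      by (simp add: K_def)
    then show "z \<in> {1..n}"
      using arcs rV by (cases rule: converse_rtranclE) auto
  qed
  have from_r: "(r, z) \<in> E\<^sup>*" if z: "z \<in> K" for z
  proof -
    \<comment> \<open>The root above \<open>z\<close> reaches \<open>r\<close> through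
      \<open>z\<close>, so it is \<open>r\<close> itself.\<close>
    obtain s where s: "s \<in> roots n F" "(s, z) \<in> E\<^sup>*"
      using root_above[OF sF] z KV forest_reachable[OF sF] by blast
    then have "(s, r) \<in> E\<^sup>*"
      using z by (auto simp: K_def)
    then show ?thesis
      using maximum_roots_not_redundant[OF F r s(1)] s(2) by simp
  qed
  have "(z, w) \<in> E\<^sup>*" if "z \<in> K" "w \<in> K" for z w
    using that from_r[of w] by (auto simp: K_def intro: rtrancl_trans)
  moreover have "r \<in> K"
    by (simp add: K_def)
  moreover have "z \<in> K" if "w \<in> K" "(z, w) \<in> E" for z w
    using that by (auto simp: K_def intro: converse_rtrancl_into_rtrancl)
  ultimately have "K \<in> undominated_knots n E"
    using KV unfolding undominated_knots_def by blast
  then show ?thesis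
    using \<open>r \<in> K\<close> by (auto simp: Ktilde_def)
qed

section \<open>Undominated knots and the sets \<open>Kplus\<close>\<close>

lemma undominated_knot_closed:
  assumes "K \<in> undominated_knots n E" "(z, w) \<in> E\<^sup>*" "w \<in> K"
  shows "z \<in> K"
  using assms(2,3)
proof (induction rule: converse_rtrancl_induct)
  case (step y z)
  then show ?case
    using assms(1) unfolding undominated_knots_def by blast
qed

lemma undominated_knot_reach:
  "K \<in> undominated_knots n E \<Longrightarrow> z \<in> K \<Longrightarrow> w \<in> K \<Longrightarrow> (z, w) \<in> E\<^sup>*"
  by (auto simp: undominated_knots_def)

text \<open>Every vertex of one knot reaches the common vertex \<open>x\<close>, and the other knot
  contains all ancestors of \<open>x\<close>.\<close>

lemma undominated_knots_disjoint:
  assumes "K \<in> undominated_knots n E" "L \<in> undominated_knots n E" "x \<in> K" "x \<in> L"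
  shows "K = L"
  using assms undominated_knot_closed undominated_knot_reach by blast

lemma knot_of_eq:
  assumes "K \<in> undominated_knots n E" "i \<in> K"
  shows "knot_of n E i = K"
  unfolding knot_of_def using assms undominated_knots_disjoint by (intro the_equality) auto

text \<open>An ancestor of \<open>i\<close> lies in the knot of \<open>i\<close> itself, which no
  other knot can reach. The contrapositive excludes paths to \<open>i\<close> from outside
  \<open>Kplus\<close>.\<close>

lemma ancestor_in_Kplus:
  assumes "i \<in> Ktilde n E" "(j, i) \<in> E\<^sup>*"
  shows "j \<in> Kplus n E i"
proof -
  obtain K where K: "K \<in> undominated_knots n E" "i \<in> K"
    using assms(1) by (auto simp: Ktilde_def)
  have jK: "j \<in> K"
    using undominated_knot_closed[OF K(1) assms(2) K(2)] .
  then have "j \<in> {1..n}"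
    using K(1) by (auto simp: undominated_knots_def)
  then have "j \<in> reachable_from n E K"
    using jK by (auto simp: reachable_from_def)
  moreover have "L = K"
    if "L \<in> undominated_knots n E" "j \<in> reachable_from n E L" for L
    using that jK K(1) undominated_knot_closed undominated_knots_disjoint
    by (fastforce simp: reachable_from_def)
  ultimately show ?thesis
    using knot_of_eq[OF K] by (auto simp: Kplus_def)
qed

text \<open>The root above \<open>j\<close> lies in a knot reaching \<open>j\<close>, which must be
  the knot of \<open>i\<close>; two roots in one knot reach each other and so coincide.\<close>

lemma Kplus_in_tree:
  assumes F: "maximum_out_forest n E F" and i: "i \<in> roots n F" and j: "j \<in> Kplus n E i"
  shows "j \<in> tree_rooted_at n F i"
proof -
  have sF: "F \<in> spanning_forests n E"
    using F by (simp add: maximum_out_forest_def)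
  have jV: "j \<in> {1..n}"
    using j by (simp add: Kplus_def reachable_from_def)
  obtain r where r: "r \<in> roots n F" "(r, j) \<in> F\<^sup>*"
    using root_above[OF sF jV] by blast
  obtain K where K: "K \<in> undominated_knots n E" "i \<in> K"
    using maximum_root_in_Ktilde[OF F i] by (auto simp: Ktilde_def)
  obtain L where L: "L \<in> undominated_knots n E" "r \<in> L"
    using maximum_root_in_Ktilde[OF F r(1)] by (auto simp: Ktilde_def)
  have "j \<in> reachable_from n E L"
    using jV L(2) forest_reachable[OF sF r(2)] by (auto simp: reachable_from_def)
  then have "L = K"
    using j L(1) knot_of_eq[OF K] by (auto simp: Kplus_def)
  then have "(r, i) \<in> E\<^sup>*"
    using K L undominated_knot_reach by blast
  then have "r = i"
    by (rule maximum_roots_not_redundant[OF F i r(1)])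
  then show ?thesis
    using tree_rooted_at_iff[OF sF] jV r by simp
qed

section \<open>Comparing entries in a column of \<open>Jbar\<close>\<close>

lemma forests_to_maximum:
  "forests_to n E (n - forest_dimension n E) j i =
    {F. maximum_out_forest n E F \<and> i \<in> tree_rooted_at n F j}"
  using forests_maximum by (auto simp: forests_to_def)

text \<open>The tree of \<open>i\<close> can contain \<open>j\<close> only if \<open>i\<close> is a
  root, and then it contains \<open>i\<close>.\<close>

lemma forests_to_subset_root:
  "forests_to n E (n - forest_dimension n E) i j \<subseteq> forests_to n E (n - forest_dimension n E) i i"
  unfolding forests_to_maximum by (auto simp: tree_rooted_at_def roots_def)

lemma forests_to_Kplus:
  assumes "j \<in> Kplus n E i"
  shows "forests_to n E (n - forest_dimension n E) i j = forests_to n E (n - forest_dimension n E) i i"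
  using forests_to_subset_root[of i j] Kplus_in_tree[OF _ _ assms]
  unfolding forests_to_maximum by (auto simp: tree_rooted_at_def)

lemma finite_forests: "finite (forests n E k)"
  using finite_spanning_forests by (simp add: forests_def)

text \<open>An empty sum vanishes, so a nonzero entry yields a maximum out forest with root
  \<open>j\<close> and a path from \<open>j\<close> to \<open>i\<close>.\<close>

lemma Jbar_nonzero:
  assumes "Jbar n E \<epsilon> i j \<noteq> 0"
  shows "j \<in> Ktilde n E" "(j, i) \<in> E\<^sup>*"
proof -
  have "forests_to n E (n - forest_dimension n E) j i \<noteq> {}"
    using assms by (auto simp: Jbar_def total_weight_def)
  then obtain F where F: "maximum_out_forest n E F" "i \<in> tree_rooted_at n F j"
    unfolding forests_to_maximum by auto
  then have sF: "F \<in> spanning_forests n E"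
    by (simp add: maximum_out_forest_def)
  show "j \<in> Ktilde n E" "(j, i) \<in> E\<^sup>*"
    using F maximum_root_in_Ktilde[OF F(1)] tree_rooted_at_iff[OF sF] forest_reachable[OF sF]
    by blast+
qed

text \<open>The numerators are sums of nonnegative weights over nested families, divided by a common
  nonnegative total.\<close>

lemma Jbar_le_diagonal:
  assumes "\<And>z w. (z, w) \<in> E \<Longrightarrow> \<epsilon> z w > 0"
  shows "Jbar n E \<epsilon> j i \<le> Jbar n E \<epsilon> i i"
proof -
  have weight: "weight \<epsilon> F \<ge> 0" if "F \<in> forests n E k" for F k
    unfolding weight_def
  proof (rule prod_nonneg)
    fix a
    assume "a \<in> F"
    then have "a \<in> E"
      using that by (auto simp: forests_def spanning_forests_def)
    then show "0 \<le> (case a of (z, w) \<Rightarrow> \<epsilon> z w)"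
      using assms by (cases a) (auto intro: less_imp_le)
  qed
  then have "total_weight \<epsilon> (forests n E k) \<ge> 0" for k
    unfolding total_weight_def by (intro sum_nonneg) auto
  moreover have "total_weight \<epsilon> (forests_to n E (n - forest_dimension n E) i j)
      \<le> total_weight \<epsilon> (forests_to n E (n - forest_dimension n E) i i)"
    unfolding total_weight_def
  proof (rule sum_mono2[OF _ forests_to_subset_root])
    show "finite (forests_to n E (n - forest_dimension n E) i i)"
      using finite_forests by (simp add: forests_to_def)
  qed (auto simp: forests_to_def intro: weight)
  ultimately show ?thesis
    unfolding Jbar_def by (intro divide_right_mono)
qed

lemma Jbar_Kplus: "j \<in> Kplus n E i \<Longrightarrow> Jbar n E \<epsilon> j i = Jbar n E \<epsilon> i i"
  by (simp add: Jbar_def forests_to_Kplus)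

end

theorem theorem3:
  fixes n :: nat and E :: "(nat \<times> nat) set" and \<epsilon> :: "nat \<Rightarrow> nat \<Rightarrow> real" and i j :: nat
  assumes "weighted_digraph n E \<epsilon>"
    and "i \<in> {1..n}" and "j \<in> {1..n}"
  shows "Jbar n E \<epsilon> i i \<ge> Jbar n E \<epsilon> j i \<and>
    (Jbar n E \<epsilon> i i > Jbar n E \<epsilon> j i \<longrightarrow>
      i \<in> Ktilde n E \<and> j \<notin> Kplus n E i \<and> (j, i) \<notin> E\<^sup>*) \<and>
    (Jbar n E \<epsilon> i i > Jbar n E \<epsilon> j i \<and> Jbar n E \<epsilon> j i > 0 \<longrightarrow>
      j \<notin> Ktilde n E \<and> (\<forall>F. maximum_out_forest n E F \<longrightarrow> j \<notin> roots n F)) \<and>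
    (Jbar n E \<epsilon> i j > 0 \<longrightarrow> Jbar n E \<epsilon> i i = Jbar n E \<epsilon> j i)"
proof -
  interpret vertex_digraph n E
    using assms(1) by unfold_locales (simp add: weighted_digraph_def)
  have le: "Jbar n E \<epsilon> j i \<le> Jbar n E \<epsilon> i i"
    using assms(1) by (intro Jbar_le_diagonal) (auto simp: weighted_digraph_def)
  have dominated: "i \<in> Ktilde n E \<and> j \<notin> Kplus n E i \<and> (j, i) \<notin> E\<^sup>*"
    if gt: "Jbar n E \<epsilon> j i < Jbar n E \<epsilon> i i"
  proof -
    \<comment> \<open>Unequal numbers are not both zero, and either entry, lying in column
      \<open>i\<close>, shows that \<open>i\<close> is a root of some maximum out forest.\<close>
    have "Jbar n E \<epsilon> i i \<noteq> 0 \<or> Jbar n E \<epsilon> j i \<noteq> 0"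
      using gt by auto
    then have "i \<in> Ktilde n E"
      by (auto dest: Jbar_nonzero)
    then show ?thesis
      using gt Jbar_Kplus[of j i \<epsilon>] ancestor_in_Kplus[of i j] by auto
  qed
  have off: "j \<notin> Ktilde n E" if "Jbar n E \<epsilon> j i < Jbar n E \<epsilon> i i" "0 < Jbar n E \<epsilon> j i"
  proof
    assume "j \<in> Ktilde n E"
    then obtain K where K: "K \<in> undominated_knots n E" "j \<in> K"
      by (auto simp: Ktilde_def)
    \<comment> \<open>If \<open>j\<close> were in a knot, this path would put \<open>i\<close> into
      the same knot, and the return path would contradict \<open>dominated\<close>.\<close>
    have "(i, j) \<in> E\<^sup>*"
      using that(2) by (intro Jbar_nonzero[of \<epsilon>]) simp
    then have "(j, i) \<in> E\<^sup>*"
      using K undominated_knot_closed undominated_knot_reach by blast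
    then show False
      using dominated that(1) by blast
  qed
  moreover have "Jbar n E \<epsilon> i i = Jbar n E \<epsilon> j i" if "0 < Jbar n E \<epsilon> i j"
  proof -
    \<comment> \<open>Here \<open>j\<close> is the root index, so the path leads to
      \<open>i\<close>; \<open>dominated\<close> then rules out strict inequality.\<close>
    have "(j, i) \<in> E\<^sup>*"
      using that by (intro Jbar_nonzero[of \<epsilon>]) simp
    then show ?thesis
      using dominated le by (metis order_le_less)
  qed
  \<comment> \<open>Roots of maximum out forests lie in \<open>Ktilde\<close>, so \<open>off\<close>
    also gives the claim on roots.\<close>
  ultimately show ?thesis
    using le dominated maximum_root_in_Ktilde by metis
qed

end
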